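(* Let $y_i$ ($i\in\mathbb{Z}$) and $q_j$ ($j\ge 1$) be independent indeterminates, and let $\mathcal{P}$ be the set of all partitions (including the empty partition). Then the family $$\Big\{\, s_{\lambda}(q_1,q_2,\ldots)\prod_{w\in\lambda} y_{c(w)} \;:\; \lambda\in\mathcal{P}\,\Big\}$$ satisfies the Plücker relations.
   Context: A partition $\lambda=(\lambda_1,\ldots,\lambda_n)$ is a list of integers with $\lambda_1\ge\cdots\ge\lambda_n\ge1$; the empty list is the partition of $0$. The Ferrers graph of $\lambda$ is the array of unit cells whose $i$th row from the top contains $\lambda_i$ cells, in columns $1,\ldots,\lambda_i$ from the left. The content of the cell $w$ in row $i$ and column $j$ is $c(w)=j-i$. Products over $w\in\lambda$ are over all cells of the Ferrers graph (empty product equal to $1$). Schur functions: define $h_i(q_1,q_2,\ldots)$ by $\sum_{i\ge0}h_i t^i=\exp\sum_{k\ge1}\frac{q_k}{k}t^k$, with $h_i=0$ for $i<0$. Then $s_\lambda(q_1,q_2,\ldots)=\det\left(h_{\lambda_i-i+j}(q_1,q_2,\ldots)\right)_{i,j=1,\ldots,n}$. Thus $q_k$ plays the role of the $k$th power sum. Plücker relations: let $\{b_\lambda:\lambda\in\mathcal{P}\}$ be a family of polynomials over $\mathbb{Q}$ in countably many indeterminates (independent of the KP variables $p_1,p_2,\ldots$). Extend $b_\lambda$ to arbitrary finite lists of integers $\lambda=(\lambda_1,\ldots,\lambda_n)$ by the following conventions. Convention 1: if $\lambda_1\ge\cdots\ge\lambda_n$ and $\lambda_n<0$, then $b_\lambda:=0$;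 if $\lambda_1\ge\cdots\ge\lambda_n$ and $\lambda_n=0$, then $b_\lambda:=b_{(\lambda_1,\ldots,\lambda_{n-1})}$. Convention 2: for $j=1,\ldots,n-1$, $b_\lambda:=-b_{\Delta_j\lambda}$, where $\Delta_j\lambda=(\lambda_1,\ldots,\lambda_{j-1},\lambda_{j+1}-1,\lambda_j+1,\lambda_{j+2},\ldots,\lambda_n)$. In particular $b_\lambda=0$ if $\lambda_{j+1}=\lambda_j+1$ for some $j$. These determine $b_\lambda$ for every list: apply Convention 2 until the list is weakly decreasing or $b_\lambda$ is seen to be $0$, then apply Convention 1. Let $\alpha=(\alpha_1,\ldots,\alpha_i)$ and $\beta=(\beta_1,\ldots,\beta_j)$ be partitions with $i$ and $j$ parts respectively, $i,j\ge0$, $(i,j)\ne(0,0)$. Let $m=\max\{i+1,j-1,2\}$ and set $\alpha_{i+1}=\cdots=\alpha_{m-1}=\beta_{j+1}=\cdots=\beta_{m+1}=0$. The family $\{b_\lambda\}$ satisfies the Plücker relations if, for every such pair $\alpha,\beta$, $$\sum_{k=0}^m(-1)^k\, b_{(\alpha_1-1,\ldots,\alpha_{m-1}-1,\,\beta_{k+1}+m-k)}\cdot b_{(\beta_1+1,\ldots,\beta_k+1,\,\beta_{k+2},\ldots,\beta_{m+1})}=0 .$$ *)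

theory Defs
  imports
    "HOL-Library.Poly_Mapping"
    "HOL-Computational_Algebra.Formal_Power_Series"
    "Jordan_Normal_Form.Determinant"
begin

subsection \<open>Polynomials over the rationals in indeterminates from an arbitrary type\<close>

type_synonym 'v qpoly = "('v \<Rightarrow>\<^sub>0 nat) \<Rightarrow>\<^sub>0 rat"

definition const :: "rat \<Rightarrow> 'v qpoly" where
  "const c = Poly_Mapping.single 0 c"

definition var :: "'v \<Rightarrow> 'v qpoly" where
  "var v = Poly_Mapping.single (Poly_Mapping.single v 1) 1"


subsection \<open>Partitions and contents\<close>

definition weakly_decreasing :: "int list \<Rightarrow> bool" where
  "weakly_decreasing la \<longleftrightarrow> sorted_wrt (\<ge>) la"

definition is_partition :: "int list \<Rightarrow> bool" where
  "is_partition la \<longleftrightarrow> weakly_decreasing la \<and> (\<forall>x\<in>set la. 1 \<le> x)"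

text \<open>A cell is a pair (row, column), both counted from 1.\<close>

definition cells :: "int list \<Rightarrow> (nat \<times> int) set" where
  "cells la = (SIGMA i : {1..length la}. {1..la ! (i - 1)})"

definition cell_content :: "nat \<times> int \<Rightarrow> int" where
  "cell_content w = snd w - int (fst w)"


subsection \<open>Schur functions in terms of power sums\<close>

text \<open>The polynomial ring is not a field, so the library's exponential series is not available
  over it; the exponential is the composition of the series with coefficients 1/n! and the
  exponent, whose constant term vanishes.\<close>

definition complete_series :: "(nat \<Rightarrow> 'v qpoly) \<Rightarrow> 'v qpoly fps" where
  "complete_series q =
     Abs_fps (\<lambda>n. const (1 / fact n)) oo
     Abs_fps (\<lambda>k. if k = 0 then 0 else const (1 / of_nat k) * q k)"

definition complete_homogeneous :: "(nat \<Rightarrow> 'v qpoly) \<Rightarrow> int \<Rightarrow> 'v qpoly" where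
  "complete_homogeneous q i = (if i < 0 then 0 else fps_nth (complete_series q) (nat i))"

definition schur :: "(nat \<Rightarrow> 'v qpoly) \<Rightarrow> int list \<Rightarrow> 'v qpoly" where
  "schur q la =
     det (mat (length la) (length la) (\<lambda>(i, j). complete_homogeneous q (la ! i - int i + int j)))"


subsection \<open>Extending a family from partitions to integer lists\<close>

text \<open>Positions are counted from 0.\<close>

definition exchange :: "nat \<Rightarrow> int list \<Rightarrow> int list" where
  "exchange j la = la[j := la ! Suc j - 1, Suc j := la ! j + 1]"

definition extends_family :: "(int list \<Rightarrow> 'a::comm_ring_1) \<Rightarrow> (int list \<Rightarrow> 'a) \<Rightarrow> bool" where
  "extends_family b B \<longleftrightarrow>
     (\<forall>la. is_partition la \<longrightarrow> B la = b la) \<and>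
     (\<forall>la. la \<noteq> [] \<and> weakly_decreasing la \<and> last la < 0 \<longrightarrow> B la = 0) \<and>
     (\<forall>la. la \<noteq> [] \<and> weakly_decreasing la \<and> last la = 0 \<longrightarrow> B la = B (butlast la)) \<and>
     (\<forall>la j. Suc j < length la \<longrightarrow> B la = - B (exchange j la)) \<and>
     (\<forall>la j. Suc j < length la \<and> la ! Suc j = la ! j + 1 \<longrightarrow> B la = 0)"

text \<open>Existence and uniqueness of this extension are shown in \<open>ex1_extension\<close> below.\<close>

definition extension :: "(int list \<Rightarrow> 'a::comm_ring_1) \<Rightarrow> int list \<Rightarrow> 'a" where
  "extension b = (THE B. extends_family b B)"


lemma extends_familyD:
  assumes "extends_family b B"
  shows "is_partition la \<Longrightarrow> B la = b la"
    and "la \<noteq> [] \<Longrightarrow> weakly_decreasing la \<Longrightarrow> last la < 0 \<Longrightarrow> B la = 0"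
    and "la \<noteq> [] \<Longrightarrow> weakly_decreasing la \<Longrightarrow> last la = 0 \<Longrightarrow> B la = B (butlast la)"
    and "Suc j < length la \<Longrightarrow> B la = - B (exchange j la)"
    and "Suc j < length la \<Longrightarrow> la ! Suc j = la ! j + 1 \<Longrightarrow> B la = 0"
  using assms unfolding extends_family_def by blast+

text \<open>Subtracting the position from each entry turns \<^const>\<open>exchange\<close> into the exchange of two
  adjacent entries.\<close>

definition shift :: "int list \<Rightarrow> int list" where
  "shift la = map (\<lambda>i. la ! i - int i) [0..<length la]"

definition unshift :: "int list \<Rightarrow> int list" where
  "unshift mu = map (\<lambda>i. mu ! i + int i) [0..<length mu]"

lemma length_shift [simp]: "length (shift la) = length la"
  by (simp add: shift_def)

lemma nth_shift [simp]: "i < length la \<Longrightarrow> shift la ! i = la ! i - int i"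
  by (simp add: shift_def)

lemma length_unshift [simp]: "length (unshift mu) = length mu"
  by (simp add: unshift_def)

lemma nth_unshift [simp]: "i < length mu \<Longrightarrow> unshift mu ! i = mu ! i + int i"
  by (simp add: unshift_def)

lemma unshift_shift [simp]: "unshift (shift la) = la"
  by (rule nth_equalityI) auto

lemma length_exchange [simp]: "length (exchange j la) = length la"
  by (simp add: exchange_def)

lemma split_adjacent:
  assumes "Suc j < length xs"
  shows "xs = take j xs @ [xs ! j, xs ! Suc j] @ drop (Suc (Suc j)) xs"
  using assms by (metis Cons_nth_drop_Suc Suc_lessD append.simps(1,2) append_take_drop_id)

lemma shift_exchange:
  assumes "Suc j < length la"
  shows "shift (exchange j la) =
    take j (shift la) @ [shift la ! Suc j, shift la ! j] @ drop (Suc (Suc j)) (shift la)"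
    (is "_ = ?r")
proof (rule nth_equalityI)
  show "length (shift (exchange j la)) = length ?r"
    using assms by simp
next
  fix i assume "i < length (shift (exchange j la))"
  then have i: "i < length la" by simp
  consider "i < j" | "i = j" | "i = Suc j" | "i > Suc j" by linarith
  then show "shift (exchange j la) ! i = ?r ! i"
  proof cases
    case 4
    then obtain k where k: "i = Suc (Suc (j + k))" by (metis less_imp_Suc_add add_Suc)
    show ?thesis using assms i unfolding k by (simp add: exchange_def nth_append min_def)
  qed (use assms i in \<open>auto simp: exchange_def nth_append min_def\<close>)
qed

fun vsign :: "int list \<Rightarrow> int" where
  "vsign [] = 1"
| "vsign (x # xs) = (\<Prod>y\<leftarrow>xs. sgn (x - y)) * vsign xs"

fun ascents :: "int list \<Rightarrow> nat" where
  "ascents [] = 0"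
| "ascents (x # xs) = length (filter (\<lambda>y. x < y) xs) + ascents xs"

lemma vsign_swap: "vsign (xs @ [x, y] @ ys) = - vsign (xs @ [y, x] @ ys)"
proof (induction xs)
  case Nil
  have "sgn (x - y) = - sgn (y - x)" by (simp add: sgn_if)
  then show ?case by simp
qed simp

lemma ascents_swap: "x < y \<Longrightarrow> ascents (xs @ [y, x] @ ys) < ascents (xs @ [x, y] @ ys)"
  by (induction xs) auto

lemma vsign_decreasing: "sorted_wrt (>) mu \<Longrightarrow> vsign mu = 1"
proof (induction mu)
  case (Cons x xs)
  have "(\<Prod>y\<leftarrow>xs. sgn (x - y)) = 1" if "\<forall>y\<in>set xs. y < x"
    using that by (induction xs) auto
  with Cons show ?case by simp
qed simp

lemma shift_decreasing:
  assumes "weakly_decreasing la"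
  shows "sorted_wrt (>) (shift la)"
  using assms unfolding weakly_decreasing_def sorted_wrt_iff_nth_less
  by (auto intro: add_le_less_mono simp: algebra_simps) (smt (verit) of_nat_less_iff)

definition trim :: "(int list \<Rightarrow> 'a::comm_ring_1) \<Rightarrow> int list \<Rightarrow> 'a" where
  "trim b la = (if \<exists>x\<in>set la. x < 0 then 0 else b (filter (\<lambda>x. x \<noteq> 0) la))"

definition straighten :: "(int list \<Rightarrow> 'a::comm_ring_1) \<Rightarrow> int list \<Rightarrow> 'a" where
  "straighten b la = of_int (vsign (shift la)) * trim b (unshift (rev (sort (shift la))))"

lemma straighten_decreasing:
  assumes "weakly_decreasing la"
  shows "straighten b la = trim b la"
proof -
  have s: "sorted_wrt (>) (shift la)" using assms by (rule shift_decreasing)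
  then have "sorted_wrt (\<ge>) (shift la)"
    by (rule sorted_wrt_mono_rel[rotated]) auto
  then have "sorted (rev (shift la))" by (simp add: sorted_wrt_rev)
  then have "sort (shift la) = rev (shift la)"
    by (metis mset_rev properties_for_sort)
  then show ?thesis using vsign_decreasing[OF s] by (simp add: straighten_def)
qed

lemma weakly_decreasing_last:
  assumes "weakly_decreasing la" "x \<in> set la"
  shows "last la \<le> x"
proof -
  from assms(2) have ne: "la \<noteq> []" by auto
  then have "la = butlast la @ [last la]" by simp
  with assms show ?thesis unfolding weakly_decreasing_def
    by (metis Un_iff append_butlast_last_id insertE ne order_refl set_append sorted_wrt_append
        list.set(1,2) empty_iff insertI1)
qed

lemma weakly_decreasing_butlast: "weakly_decreasing la \<Longrightarrow> weakly_decreasing (butlast la)"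
  unfolding weakly_decreasing_def by (metis butlast_conv_take sorted_wrt_take)

lemma straighten_exchange:
  assumes "Suc j < length la"
  shows "straighten b la = - straighten b (exchange j la)"
proof -
  let ?m = "shift la"
  let ?xs = "take j ?m" and ?ys = "drop (Suc (Suc j)) ?m" and ?x = "?m ! j" and ?y = "?m ! Suc j"
  have m: "?m = ?xs @ [?x, ?y] @ ?ys" using assms by (intro split_adjacent) simp
  have e: "shift (exchange j la) = ?xs @ [?y, ?x] @ ?ys" by (rule shift_exchange[OF assms])
  have "vsign ?m = - vsign (shift (exchange j la))"
    unfolding e by (subst m) (rule vsign_swap)
  moreover have "mset ?m = mset (shift (exchange j la))"
    unfolding e by (subst m) simp
  then have "sort ?m = sort (shift (exchange j la))"
    by (metis mset_sort properties_for_sort sorted_sort)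
  ultimately show ?thesis by (simp add: straighten_def)
qed

lemma straighten_zero:
  assumes "Suc j < length la" "la ! Suc j = la ! j + 1"
  shows "straighten b la = 0"
proof -
  have "shift (exchange j la) = shift la"
    using assms shift_exchange[OF assms(1)] split_adjacent[of j "shift la"] by simp
  then have "exchange j la = la" by (metis unshift_shift)
  then have "vsign (shift la) = - vsign (shift la)"
    using assms vsign_swap[of "take j (shift la)" "shift la ! j" "shift la ! Suc j"
        "drop (Suc (Suc j)) (shift la)"] split_adjacent[of j "shift la"] by simp
  then show ?thesis by (simp add: straighten_def)
qed

lemma extends_family_straighten: "extends_family b (straighten b)"
  unfolding extends_family_def
proof (intro conjI allI impI; (elim conjE)?)
  fix la assume p: "is_partition la"
  then have "trim b la = b la"
    by (auto simp: is_partition_def trim_def filter_id_conv intro!: arg_cong[where f = b])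
      (force simp: filter_id_conv)+
  with p show "straighten b la = b la"
    by (simp add: straighten_decreasing is_partition_def)
next
  fix la assume "la \<noteq> []" "weakly_decreasing la" "last la < 0"
  then show "straighten b la = 0"
    by (auto simp: straighten_decreasing trim_def dest: last_in_set)
next
  fix la assume a: "la \<noteq> []" "weakly_decreasing la" "last la = 0"
  then have e: "la = butlast la @ [0]" by (metis append_butlast_last_id)
  have "trim b la = trim b (butlast la)"
    by (subst e, subst (2) e) (simp add: trim_def)
  with a show "straighten b la = straighten b (butlast la)"
    by (simp add: straighten_decreasing weakly_decreasing_butlast)
qed (blast intro: straighten_exchange straighten_zero)+

lemma extends_family_unique:
  assumes B: "extends_family b B" and C: "extends_family b C"
  shows "B la = C la"
proof (induction "(length la, ascents (shift la))" arbitrary: la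
    rule: wf_induct_rule[OF wf_lex_prod[OF wf_less_than wf_less_than]])
  case 1
  note IH = this
  show ?case
  proof (cases "weakly_decreasing la")
    case True
    show ?thesis
    proof (cases "is_partition la")
      case True
      then show ?thesis using extends_familyD(1)[OF B] extends_familyD(1)[OF C] by simp
    next
      case False
      then obtain x where x: "x \<in> set la" "x < 1"
        using True by (auto simp: is_partition_def)
      then have ne: "la \<noteq> []" by auto
      have "last la \<le> 0" using weakly_decreasing_last[OF True x(1)] x by simp
      then consider "last la < 0" | "last la = 0" by linarith
      then show ?thesis
      proof cases
        case 1
        then show ?thesis
          using extends_familyD(2)[OF B ne True] extends_familyD(2)[OF C ne True] by simp
      next
        case 2
        have "B (butlast la) = C (butlast la)" using ne by (intro IH) auto
        then show ?thesis
          using 2 extends_familyD(3)[OF B ne True] extends_familyD(3)[OF C ne True] by simp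
      qed
    qed
  next
    case False
    then obtain j where j: "Suc j < length la" "la ! j < la ! Suc j"
      unfolding weakly_decreasing_def
      by (subst (asm) sorted_wrt_iff_nth_Suc_transp) (auto simp: not_le transp_def)
    show ?thesis
    proof (cases "la ! Suc j = la ! j + 1")
      case True
      then show ?thesis
        using extends_familyD(5)[OF B j(1)] extends_familyD(5)[OF C j(1)] by simp
    next
      case False
      with j have "shift la ! j < shift la ! Suc j" by simp
      from ascents_swap[OF this, of "take j (shift la)" "drop (Suc (Suc j)) (shift la)"]
      have "ascents (shift (exchange j la)) < ascents (shift la)"
        using shift_exchange[OF j(1)] split_adjacent[of j "shift la"] j(1) by simp
      then have "B (exchange j la) = C (exchange j la)" by (intro IH) auto
      then show ?thesis
        using extends_familyD(4)[OF B j(1)] extends_familyD(4)[OF C j(1)] by simp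
    qed
  qed
qed

theorem ex1_extension: "\<exists>!B. extends_family b B"
  using extends_family_straighten extends_family_unique by (metis ext)

lemma extends_family_extension: "extends_family b (extension b)"
  unfolding extension_def by (rule theI'[OF ex1_extension])


subsection \<open>The Pluecker relations\<close>

definition pad :: "nat \<Rightarrow> int list \<Rightarrow> int list" where
  "pad n la = la @ replicate (n - length la) 0"

text \<open>The truncated difference in the maximum is harmless: for empty \<open>be\<close> it is 0 instead of -1.\<close>

definition pluecker_relations :: "(int list \<Rightarrow> 'a::comm_ring_1) \<Rightarrow> bool" where
  "pluecker_relations b \<longleftrightarrow>
     (\<forall>al be. is_partition al \<and> is_partition be \<and> (length al, length be) \<noteq> (0, 0) \<longrightarrow>
       (let m = Max {length al + 1, length be - 1, 2::nat};
            al' = pad (m - 1) al;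
            be' = pad (m + 1) be
        in (\<Sum>k = 0..m. (- 1) ^ k *
              extension b (map (\<lambda>x. x - 1) al' @ [be' ! k + int m - int k]) *
              extension b (map (\<lambda>x. x + 1) (take k be') @ drop (Suc k) be')) = 0))"


subsection \<open>The indeterminates\<close>

text \<open>\<open>Y i\<close> is the index of \<open>y\<^sub>i\<close> and \<open>Q k\<close> that of \<open>q\<^sub>k\<close>; \<open>Q 0\<close> occurs in no Schur function,
  because \<^const>\<open>complete_series\<close> ignores \<open>q 0\<close>.\<close>

datatype indeterminate = Y int | Q nat

end

theory Submission
  imports Defs
begin

text \<open>
  Pass from an integer list \<open>\<lambda>\<close> to the shifted list \<open>\<mu>\<close> with \<open>\<mu>\<^sub>i = \<lambda>\<^sub>i - i\<close>, positions counted from 0.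
  Row \<open>i\<close> of the Jacobi--Trudi matrix of \<open>\<lambda>\<close> is then \<open>(h(\<mu>\<^sub>i), h(\<mu>\<^sub>i + 1), \<dots>)\<close>, a vector that depends
  on \<open>\<mu>\<^sub>i\<close> only, and the contents in row \<open>i\<close> of the Ferrers graph are \<open>-i, \<dots>, \<mu>\<^sub>i - 1\<close>.  Hence \<open>y\<^sub>c\<close>
  occurs in the content product with exponent
  \<open>|{i. c < \<mu>\<^sub>i}| - |{i. c < -i}|\<close>, which is symmetric in the \<open>\<mu>\<^sub>i\<close>.  The product of this monomial
  with the determinant is defined for every integer list, and it obeys both conventions:
  it is alternating in \<open>\<mu>\<close>, vanishes if a row of the matrix vanishes, and does not change when a
  zero is appended to \<open>\<lambda>\<close>.  So it is the extension of the given family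
  (\<open>extends_family_weighted_alternant\<close>).

  Let \<open>u\<close> be the shifted list of \<open>(\<alpha>\<^sub>1 - 1, \<dots>, \<alpha>\<^sub>m\<^sub>-\<^sub>1 - 1)\<close>, and \<open>v\<close> the shifted list of
  \<open>(\<beta>\<^sub>1 + 1, \<dots>, \<beta>\<^sub>m\<^sub>+\<^sub>1 + 1)\<close>.  The two lists in the \<open>k\<close>-th term of a Pluecker relation shift to
  \<open>u\<close> followed by \<open>v\<^sub>k\<close>, and to \<open>v\<close> without \<open>v\<^sub>k\<close>.  Together they contain the same entries for
  every \<open>k\<close>, so the two content monomials have a product that does not depend on \<open>k\<close> and
  factors out of the sum.  What is left is the classical exchange identity for the maximal minors
  of \<open>2m\<close> vectors in dimension \<open>m\<close> (\<open>alternant_pluecker\<close>).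

  One point needs care, because the \<open>y\<^sub>c\<close> are not invertible: the exponents above are
  differences of natural numbers, and they add up as claimed only if neither is negative.  This
  holds whenever the determinant does not vanish (\<open>ground_le_count_above_if_alternant\<close>), and terms
  with a vanishing determinant can be ignored.  The argument works over every commutative ring, for
  arbitrary ring elements \<open>y\<^sub>c\<close> and every \<open>h\<close> with \<open>h(0) = 1\<close> and \<open>h(i) = 0\<close> for \<open>i < 0\<close>.
\<close>

section \<open>Jacobi--Trudi determinants of shifted lists\<close>

definition alternant :: "(int \<Rightarrow> 'a::comm_ring_1) \<Rightarrow> int list \<Rightarrow> 'a" where
  "alternant h mu = det (mat (length mu) (length mu) (\<lambda>(i, j). h (mu ! i + int j)))"

lemma alternant_swap:
  "alternant h (xs @ [x, y] @ ys) = - alternant h (xs @ [y, x] @ ys)"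
proof -
  let ?u = "xs @ [x, y] @ ys" and ?v = "xs @ [y, x] @ ys" and ?k = "length xs"
  let ?n = "length ?v"
  let ?A = "mat ?n ?n (\<lambda>(i, j). h (?v ! i + int j))"
  have "mat ?n ?n (\<lambda>(i, j). h (?u ! i + int j)) = swaprows ?k (Suc ?k) ?A"
  proof (rule eq_matI, goal_cases)
    case (1 i j)
    consider "i < ?k" | "i = ?k" | "i = Suc ?k" | l where "i = Suc (Suc (?k + l))"
      by (metis add_Suc less_imp_Suc_add linorder_less_linear Suc_lessI)
    then show ?case
      using 1 by cases (auto simp: nth_append)
  qed auto
  then have "alternant h ?u = det (swaprows ?k (Suc ?k) ?A)"
    by (simp add: alternant_def)
  also have "\<dots> = - det ?A"
    by (rule det_swaprows[of _ ?n]) auto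
  finally show ?thesis by (simp add: alternant_def)
qed

lemma alternant_eq_0_if_not_distinct:
  assumes "\<not> distinct mu"
  shows "alternant h mu = 0"
proof -
  from assms obtain i j where ij: "i < length mu" "j < length mu" "i \<noteq> j" "mu ! i = mu ! j"
    by (auto simp: distinct_conv_nth)
  show ?thesis
    unfolding alternant_def
    by (rule det_identical_rows[OF _ ij(3,1,2)]) (use ij in \<open>auto intro!: eq_vecI\<close>)
qed

text \<open>The row that belongs to \<open>x\<close> ends with \<open>h (x + n - 1)\<close> for \<open>n = length mu\<close>, so all its
  arguments are negative.\<close>

lemma alternant_eq_0_if_low:
  assumes h: "\<And>i. i < 0 \<Longrightarrow> h i = 0" and x: "x \<in> set mu" "x \<le> - int (length mu)"
  shows "alternant h mu = 0"
proof -
  from x obtain i where i: "i < length mu" "mu ! i \<le> - int (length mu)"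
    by (auto simp: in_set_conv_nth)
  show ?thesis
    unfolding alternant_def
    by (subst laplace_expansion_row[of _ "length mu" i])
      (use i in \<open>auto intro!: sum.neutral simp: h\<close>)
qed

text \<open>The new entry is the shift of a part 0.  It contributes the row \<open>(0, \<dots>, 0, 1)\<close>, along which
  the determinant is expanded.\<close>

lemma alternant_snoc_lowest:
  assumes h: "\<And>i. i < 0 \<Longrightarrow> h i = 0" and h0: "h 0 = 1"
  shows "alternant h (mu @ [- int (length mu)]) = alternant h mu"
proof -
  let ?n = "length mu" and ?u = "mu @ [- int (length mu)]"
  let ?A = "mat (Suc ?n) (Suc ?n) (\<lambda>(i, j). h (?u ! i + int j))"
  have "mat_delete ?A ?n ?n = mat ?n ?n (\<lambda>(i, j). h (mu ! i + int j))"
    by (rule eq_matI) (auto simp: mat_delete_def nth_append)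
  moreover have "det ?A = (\<Sum>j<Suc ?n. ?A $$ (?n, j) * cofactor ?A ?n j)"
    by (rule laplace_expansion_row) auto
  moreover have "\<dots> = cofactor ?A ?n ?n"
    by (simp add: h h0)
  ultimately show ?thesis
    by (simp add: alternant_def cofactor_def)
qed

text \<open>The coefficients \<open>w\<close> are the cofactors of the last row.  They are the same for all \<open>x\<close>, so
  that linear relations between the rows of several \<open>x\<close> carry over to these determinants.\<close>

lemma alternant_snoc_expand:
  obtains w where
    "\<And>x. alternant h (a @ [x]) = (\<Sum>c<Suc (length a). h (x + int c) * w c)"
proof
  fix x
  let ?n = "length a"
  let ?A = "\<lambda>x. mat (Suc ?n) (Suc ?n) (\<lambda>(i, j). h ((a @ [x]) ! i + int j))"
  have "mat_delete (?A x) ?n c = mat_delete (?A 0) ?n c" for c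
    by (rule eq_matI) (auto simp: mat_delete_def nth_append)
  then have cof: "cofactor (?A x) ?n c = cofactor (?A 0) ?n c" for c
    by (simp add: cofactor_def)
  have "alternant h (a @ [x]) = (\<Sum>c<Suc ?n. ?A x $$ (?n, c) * cofactor (?A x) ?n c)"
    unfolding alternant_def by (subst laplace_expansion_row[of _ "Suc ?n" ?n]) auto
  also have "\<dots> = (\<Sum>c<Suc ?n. h (x + int c) * cofactor (?A 0) ?n c)"
    unfolding cof by (rule sum.cong) auto
  finally show "alternant h (a @ [x]) = (\<Sum>c<Suc ?n. h (x + int c) * cofactor (?A 0) ?n c)" .
qed

text \<open>Cramer's rule: this is the relation between \<open>n + 1\<close> row vectors of length \<open>n\<close>, read off at
  coordinate \<open>c\<close>.  Put a copy of column \<open>c\<close> in front of the matrix of these rows.  The square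
  matrix that arises has two equal columns, and the sum is the expansion of its determinant along
  the first.\<close>

lemma rows_linear_relation:
  assumes b: "length b = Suc n" and c: "c < n"
  shows "(\<Sum>k\<le>n. (- 1) ^ k * h (b ! k + int c) * alternant h (take k b @ drop (Suc k) b)) = 0"
proof -
  let ?A = "mat (Suc n) (Suc n) (\<lambda>(k, j). h (b ! k + int (if j = 0 then c else j - 1)))"
  have A0: "det ?A = 0"
    by (rule det_identical_columns[of _ "Suc n" 0 "Suc c"]) (use c in \<open>auto intro!: eq_vecI\<close>)
  have "mat_delete ?A k 0 = mat n n (\<lambda>(i, j). h ((take k b @ drop (Suc k) b) ! i + int j))"
    if "k \<le> n" for k
    by (rule eq_matI) (use that b in \<open>auto simp: mat_delete_def nth_append min_def\<close>)
  then have cof: "cofactor ?A k 0 = (- 1) ^ k * alternant h (take k b @ drop (Suc k) b)"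
    if "k \<le> n" for k
    using that b by (simp add: cofactor_def alternant_def min_def)
  have "0 = (\<Sum>k<Suc n. ?A $$ (k, 0) * cofactor ?A k 0)"
    unfolding A0[symmetric] by (rule laplace_expansion_column) auto
  also have "\<dots> = (\<Sum>k<Suc n. (- 1) ^ k * h (b ! k + int c) * alternant h (take k b @ drop (Suc k) b))"
    by (rule sum.cong) (auto simp: cof)
  finally show ?thesis by (simp add: lessThan_Suc_atMost)
qed

text \<open>The determinant of \<open>a @ [b ! k]\<close> is a linear functional of the row of \<open>b ! k\<close>, and the other
  factors are the coefficients of a linear relation between the rows of \<open>b\<close>.\<close>

lemma alternant_pluecker:
  assumes b: "length b = length a + 2"
  shows "(\<Sum>k\<le>Suc (length a). (- 1) ^ k * alternant h (a @ [b ! k]) *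
    alternant h (take k b @ drop (Suc k) b)) = 0"
proof -
  let ?n = "Suc (length a)"
  let ?B = "\<lambda>k. alternant h (take k b @ drop (Suc k) b)"
  obtain w where w: "\<And>x. alternant h (a @ [x]) = (\<Sum>c<?n. h (x + int c) * w c)"
    using alternant_snoc_expand[of h a] by blast
  have "(\<Sum>k\<le>?n. (- 1) ^ k * alternant h (a @ [b ! k]) * ?B k) =
    (\<Sum>k\<le>?n. \<Sum>c<?n. w c * ((- 1) ^ k * h (b ! k + int c) * ?B k))"
    unfolding w by (simp only: sum_distrib_left sum_distrib_right mult_ac)
  also have "\<dots> = (\<Sum>c<?n. w c * (\<Sum>k\<le>?n. (- 1) ^ k * h (b ! k + int c) * ?B k))"
    by (subst sum.swap) (simp only: sum_distrib_left)
  also have "\<dots> = 0"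
    by (rule sum.neutral) (use b in \<open>simp add: rows_linear_relation del: sum.atMost_Suc\<close>)
  finally show ?thesis .
qed

section \<open>Content monomials of shifted lists\<close>

definition count_above :: "int list \<Rightarrow> int \<Rightarrow> nat" where
  "count_above mu c = length (filter (\<lambda>x. c < x) mu)"

text \<open>The shift of \<open>n\<close> zeros, that is, of the empty partition written with \<open>n\<close> parts.\<close>

definition ground :: "nat \<Rightarrow> int list" where
  "ground n = map (\<lambda>i. - int i) [0..<n]"

text \<open>The number of cells of content \<open>c\<close> if \<open>mu\<close> is the shift of a partition (see
  \<open>card_cells_content\<close>).  The subtraction is truncated: this makes the exponent total, and it
  alters the value only where the determinant vanishes.\<close>

definition excess :: "int list \<Rightarrow> int \<Rightarrow> nat" where
  "excess mu c = count_above mu c - count_above (ground (length mu)) c"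

definition monom_of :: "(int \<Rightarrow> 'a::comm_ring_1) \<Rightarrow> (int \<Rightarrow> nat) \<Rightarrow> 'a" where
  "monom_of y e = (\<Prod>c. y c ^ e c)"

lemma count_above_append [simp]: "count_above (xs @ ys) c = count_above xs c + count_above ys c"
  by (simp add: count_above_def)

lemma count_above_conv_card: "count_above mu c = card {i. i < length mu \<and> c < mu ! i}"
  by (simp add: count_above_def length_filter_conv_card)

lemma length_ground [simp]: "length (ground n) = n"
  by (simp add: ground_def)

text \<open>Every entry of \<open>mu\<close> and of the ground list exceeds a very small \<open>c\<close>, so that the two counts
  are equal, and no entry exceeds a very large \<open>c\<close>.\<close>

lemma finite_excess: "finite {c. excess mu c \<noteq> 0}"
proof -
  let ?S = "set (mu @ ground (length mu))"
  have "c \<in> {Min ?S..Max ?S}" if "excess mu c \<noteq> 0" for c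
  proof -
    from that have gt: "count_above mu c > count_above (ground (length mu)) c"
      by (simp add: excess_def)
    then have "filter (\<lambda>x. c < x) mu \<noteq> []" by (auto simp: count_above_def)
    then obtain x where x: "x \<in> set mu" "c < x" by (auto simp: filter_empty_conv)
    have "\<not> (\<forall>z\<in>set (ground (length mu)). c < z)"
    proof
      assume "\<forall>z\<in>set (ground (length mu)). c < z"
      then have "count_above (ground (length mu)) c = length mu"
        by (simp add: count_above_def)
      moreover have "count_above mu c \<le> length mu" by (simp add: count_above_def)
      ultimately show False using gt by simp
    qed
    then obtain z where "z \<in> set (ground (length mu))" "z \<le> c" by (auto simp: not_less)
    then have "Min ?S \<le> c" by (intro order.trans[OF Min_le]) auto
    moreover from x(1) have "x \<le> Max ?S" by (intro Max_ge) auto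
    with x(2) have "c \<le> Max ?S" by linarith
    ultimately show ?thesis by (simp only: atLeastAtMost_iff)
  qed
  then show ?thesis by (intro finite_subset[OF _ finite_atLeastAtMost_int]) blast
qed

lemma monom_of_add:
  assumes "finite {c. e c \<noteq> 0}" "finite {c. f c \<noteq> 0}"
  shows "monom_of y (\<lambda>c. e c + f c) = monom_of y e * monom_of y f"
proof -
  have "finite {c. y c ^ g c \<noteq> 1}" if "finite {c. g c \<noteq> 0}" for g :: "int \<Rightarrow> nat"
    by (rule finite_subset[OF _ that]) (auto intro: ccontr)
  with assms show ?thesis
    unfolding monom_of_def power_add by (intro Prod_any.distrib) auto
qed

text \<open>For negative \<open>c\<close>, the entries of \<open>mu\<close> up to \<open>c\<close> are distinct integers in
  \<open>{- n + 1..c}\<close> with \<open>n = length mu\<close>, and the ground list contains every integer of that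
  interval.  Hence at most as many entries of \<open>mu\<close> as of the ground list fail to exceed \<open>c\<close>.\<close>

lemma ground_le_count_above:
  assumes d: "distinct mu" and low: "\<forall>x\<in>set mu. - int (length mu) < x"
  shows "count_above (ground (length mu)) c \<le> count_above mu c"
proof (cases "c \<ge> 0")
  case True
  then have "count_above (ground (length mu)) c = 0"
    by (auto simp: count_above_def ground_def filter_empty_conv)
  then show ?thesis by simp
next
  case False
  have compl: "length (filter (\<lambda>x. \<not> c < x) xs) + count_above xs c = length xs" for xs
    using sum_length_filter_compl[of "\<lambda>x. c < x" xs] by (simp add: count_above_def)
  have dg: "distinct (ground (length mu))"
    by (auto simp: ground_def distinct_map inj_on_def)
  have "set (filter (\<lambda>x. \<not> c < x) mu) \<subseteq> set (filter (\<lambda>x. \<not> c < x) (ground (length mu)))"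
  proof
    fix x assume x: "x \<in> set (filter (\<lambda>x. \<not> c < x) mu)"
    then have "- int (length mu) < x" "x < 0" using False low by auto
    then have "x = - int (nat (- x))" "nat (- x) < length mu" by auto
    then have "x \<in> set (ground (length mu))"
      unfolding ground_def set_map by (intro image_eqI[of _ _ "nat (- x)"]) auto
    with x show "x \<in> set (filter (\<lambda>x. \<not> c < x) (ground (length mu)))"
      by simp
  qed
  then have "length (filter (\<lambda>x. \<not> c < x) mu) \<le> length (filter (\<lambda>x. \<not> c < x) (ground (length mu)))"
    by (metis List.finite_set card_mono d dg distinct_card distinct_filter)
  then show ?thesis using compl[of mu] compl[of "ground (length mu)"] by simp
qed

lemma ground_le_count_above_if_alternant:
  assumes h: "\<And>i. i < 0 \<Longrightarrow> h i = 0" and "alternant h mu \<noteq> 0"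
  shows "count_above (ground (length mu)) c \<le> count_above mu c"
  using assms alternant_eq_0_if_not_distinct[of mu h] alternant_eq_0_if_low[of h _ mu]
  by (intro ground_le_count_above) (auto simp: not_le[symmetric])

section \<open>Pluecker relations for weighted determinants\<close>

definition weighted_alternant ::
  "(int \<Rightarrow> 'a::comm_ring_1) \<Rightarrow> (int \<Rightarrow> 'a) \<Rightarrow> int list \<Rightarrow> 'a" where
  "weighted_alternant h y mu = alternant h mu * monom_of y (excess mu)"

text \<open>The entries of the two lists make up \<open>a\<close> and \<open>b\<close> together for every \<open>k\<close>, so one monomial
  \<open>M\<close> factors out of the whole sum.\<close>

lemma weighted_alternant_pluecker:
  assumes h: "\<And>i. i < 0 \<Longrightarrow> h i = 0" and b: "length b = length a + 2"
  shows "(\<Sum>k\<le>Suc (length a). (- 1) ^ k * weighted_alternant h y (a @ [b ! k]) *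
    weighted_alternant h y (take k b @ drop (Suc k) b)) = 0"
proof -
  let ?n = "Suc (length a)"
  let ?a = "\<lambda>k. a @ [b ! k]" and ?b = "\<lambda>k. take k b @ drop (Suc k) b"
  define M where
    "M = monom_of y (\<lambda>c. count_above a c + count_above b c - 2 * count_above (ground ?n) c)"
  \<comment> \<open>If a determinant vanishes, the monomials may differ from \<open>M\<close>, but both sides are 0.\<close>
  have term_eq: "weighted_alternant h y (?a k) * weighted_alternant h y (?b k) =
      M * (alternant h (?a k) * alternant h (?b k))" if k: "k \<le> ?n" for k
  proof (cases "alternant h (?a k) = 0 \<or> alternant h (?b k) = 0")
    case True
    then show ?thesis by (auto simp: weighted_alternant_def)
  next
    case False
    have len: "length (?b k) = ?n" using b k by (simp add: min_def)
    have split: "b = take k b @ [b ! k] @ drop (Suc k) b"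
      using b k by (simp add: id_take_nth_drop)
    have "excess (?a k) c + excess (?b k) c =
        count_above a c + count_above b c - 2 * count_above (ground ?n) c" for c
    proof -
      have "count_above (ground ?n) c \<le> count_above (?a k) c"
        using ground_le_count_above_if_alternant[of h "?a k" c] h False by simp
      moreover have "count_above (ground ?n) c \<le> count_above (?b k) c"
        using ground_le_count_above_if_alternant[of h "?b k" c] h False unfolding len by simp
      moreover have "count_above (?a k) c + count_above (?b k) c = count_above a c + count_above b c"
        by (subst (3) split) (simp only: count_above_append add_ac)
      ultimately show ?thesis
        unfolding excess_def len by simp
    qed
    then have "monom_of y (excess (?a k)) * monom_of y (excess (?b k)) = M"
      unfolding M_def by (simp only: monom_of_add[OF finite_excess finite_excess, symmetric])
    then show ?thesis by (simp add: weighted_alternant_def mult_ac)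
  qed
  have "(\<Sum>k\<le>?n. (- 1) ^ k * weighted_alternant h y (?a k) * weighted_alternant h y (?b k)) =
      (\<Sum>k\<le>?n. M * ((- 1) ^ k * alternant h (?a k) * alternant h (?b k)))"
  proof (rule sum.cong)
    fix k assume "k \<in> {..?n}"
    then show "(- 1) ^ k * weighted_alternant h y (?a k) * weighted_alternant h y (?b k) =
        M * ((- 1) ^ k * alternant h (?a k) * alternant h (?b k))"
      using term_eq[of k] by (simp add: mult.assoc mult.left_commute)
  qed simp
  also have "\<dots> = 0"
    unfolding sum_distrib_left[symmetric] alternant_pluecker[OF b] by simp
  finally show ?thesis .
qed

section \<open>The extension of a content-weighted family\<close>

text \<open>Row \<open>i\<close>, counted from 0, has a cell of content \<open>c\<close> iff \<open>- i \<le> c < shift la ! i\<close>, and then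
  exactly one, in column \<open>c + i + 1\<close>.  As \<open>- i < shift la ! i\<close> for a partition, the number of such
  rows is a difference of two counts.\<close>

lemma card_cells_content:
  assumes "is_partition la"
  shows "card {w \<in> cells la. cell_content w = c} = excess (shift la) c"
proof -
  let ?n = "length la" and ?mu = "shift la"
  let ?U = "{i. i < ?n \<and> c < ?mu ! i}" and ?G = "{i. i < ?n \<and> c < - int i}"
  have pos: "1 \<le> la ! i" if "i < ?n" for i
    using assms that by (auto simp: is_partition_def)
  have "bij_betw (\<lambda>i. (Suc i, c + int i + 1)) (?U - ?G) {w \<in> cells la. cell_content w = c}"
    by (rule bij_betw_byWitness[where f' = "\<lambda>w. fst w - 1"])
      (auto simp: cells_def cell_content_def Suc_le_eq)
  then have "card {w \<in> cells la. cell_content w = c} = card (?U - ?G)"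
    by (simp add: bij_betw_same_card)
  moreover have "?G \<subseteq> ?U"
    using pos by fastforce
  then have "card (?U - ?G) = card ?U - card ?G"
    by (intro card_Diff_subset) auto
  moreover have "card ?U - card ?G = excess ?mu c"
    by (simp add: excess_def count_above_conv_card ground_def cong: conj_cong)
  ultimately show ?thesis by simp
qed

lemma prod_cells_eq_monom_of:
  assumes "is_partition la"
  shows "(\<Prod>w\<in>cells la. y (cell_content w)) = monom_of y (excess (shift la))"
proof -
  have fin: "finite (cells la)" by (simp add: cells_def)
  have "(\<Prod>w\<in>cells la. y (cell_content w)) =
      (\<Prod>c\<in>cell_content ` cells la. \<Prod>w\<in>{w \<in> cells la. cell_content w = c}. y (cell_content w))"
    by (rule prod.image_gen[OF fin])
  also have "\<dots> = (\<Prod>c\<in>cell_content ` cells la. y c ^ excess (shift la) c)"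
    by (rule prod.cong) (simp_all add: card_cells_content[OF assms, symmetric])
  also have "\<dots> = monom_of y (excess (shift la))"
    unfolding monom_of_def
  proof (rule Prod_any.expand_superset[symmetric])
    show "{c. y c ^ excess (shift la) c \<noteq> 1} \<subseteq> cell_content ` cells la"
    proof
      fix c assume "c \<in> {c. y c ^ excess (shift la) c \<noteq> 1}"
      then have "excess (shift la) c \<noteq> 0" by (auto intro: ccontr)
      then have "{w \<in> cells la. cell_content w = c} \<noteq> {}"
        unfolding card_cells_content[OF assms, symmetric] by (metis card.empty)
      then show "c \<in> cell_content ` cells la" by auto
    qed
  qed (simp add: fin)
  finally show ?thesis .
qed

text \<open>\<open>exchange\<close> permutes the shifted entries, so this makes the content monomial invariant under
  it, and the sign in the second convention comes from the determinant alone.\<close>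

lemma excess_mset:
  assumes "mset mu = mset nu"
  shows "excess mu = excess nu"
proof -
  have "length mu = length nu" using assms by (rule mset_eq_length)
  moreover have "count_above mu c = count_above nu c" for c
    using assms unfolding count_above_def by (metis mset_filter size_mset)
  ultimately show ?thesis by (simp add: excess_def fun_eq_iff)
qed

lemma excess_snoc_lowest: "excess (mu @ [- int (length mu)]) = excess mu"
  by (simp add: excess_def ground_def fun_eq_iff)

lemma shift_snoc: "shift (la @ [x]) = shift la @ [x - int (length la)]"
  by (simp add: shift_def nth_append cong: map_cong)

lemma extends_family_weighted_alternant:
  assumes h: "\<And>i. i < 0 \<Longrightarrow> h i = 0" and h0: "h 0 = 1"
    and b: "\<And>la. is_partition la \<Longrightarrow>
      b la = alternant h (shift la) * (\<Prod>w\<in>cells la. y (cell_content w))"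
  shows "extends_family b (\<lambda>la. weighted_alternant h y (shift la))"
  unfolding extends_family_def
proof (intro conjI allI impI; (elim conjE)?)
  fix la assume "is_partition la"
  then show "weighted_alternant h y (shift la) = b la"
    by (simp add: b weighted_alternant_def prod_cells_eq_monom_of)
next
  fix la :: "int list" assume "la \<noteq> []" "last la < 0"
  then have "last (shift la) \<in> set (shift la)" "last (shift la) \<le> - int (length (shift la))"
    by (auto simp: last_conv_nth shift_def last_in_set)
  then show "weighted_alternant h y (shift la) = 0"
    using alternant_eq_0_if_low[of h] h by (simp add: weighted_alternant_def)
next
  fix la :: "int list" assume "la \<noteq> []" "last la = 0"
  then have "shift la = shift (butlast la) @ [- int (length (shift (butlast la)))]"
    using shift_snoc[of "butlast la" 0] by (metis append_butlast_last_id diff_0 length_shift)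
  then show "weighted_alternant h y (shift la) = weighted_alternant h y (shift (butlast la))"
    unfolding weighted_alternant_def
    using alternant_snoc_lowest[of h "shift (butlast la)"] h h0 excess_snoc_lowest by metis
next
  fix la :: "int list" and j assume j: "Suc j < length la"
  let ?xs = "take j (shift la)" and ?ys = "drop (Suc (Suc j)) (shift la)"
  let ?x = "shift la ! j" and ?y = "shift la ! Suc j"
  have m: "shift la = ?xs @ [?x, ?y] @ ?ys" using j by (intro split_adjacent) simp
  have e: "shift (exchange j la) = ?xs @ [?y, ?x] @ ?ys" by (rule shift_exchange[OF j])
  have "alternant h (shift la) = - alternant h (shift (exchange j la))"
    unfolding e by (subst m) (rule alternant_swap)
  moreover have "excess (shift la) = excess (shift (exchange j la))"
    unfolding e by (subst m) (rule excess_mset, simp)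
  ultimately show "weighted_alternant h y (shift la) = - weighted_alternant h y (shift (exchange j la))"
    by (simp add: weighted_alternant_def)
next
  fix la :: "int list" and j assume "Suc j < length la" "la ! Suc j = la ! j + 1"
  then have "shift la ! j = shift la ! Suc j" "Suc j < length (shift la)" by auto
  then have "\<not> distinct (shift la)"
    by (metis Suc_lessD n_not_Suc_n nth_eq_iff_index_eq)
  then show "weighted_alternant h y (shift la) = 0"
    by (simp add: weighted_alternant_def alternant_eq_0_if_not_distinct)
qed

text \<open>The shifts of the two lists in the \<open>k\<close>-th term become \<open>u @ [v ! k]\<close> and \<open>v\<close> without its
  \<open>k\<close>-th entry.  Raising all of \<open>v\<close> by 1 accounts both for the \<open>\<beta>\<^sub>i + 1\<close> before the gap and for
  the parts after it, which move up by one position.\<close>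

lemma pluecker_relations_content_weighted:
  assumes h: "\<And>i. i < 0 \<Longrightarrow> h i = 0" and h0: "h 0 = 1"
    and b: "\<And>la. is_partition la \<Longrightarrow>
      b la = alternant h (shift la) * (\<Prod>w\<in>cells la. y (cell_content w))"
  shows "pluecker_relations b"
proof -
  have "extends_family b (\<lambda>la. weighted_alternant h y (shift la))"
    by (rule extends_family_weighted_alternant[OF h h0 b])
  then have ext: "extension b la = weighted_alternant h y (shift la)" for la
    by (rule extends_family_unique[OF extends_family_extension])
  show ?thesis
    unfolding pluecker_relations_def
  proof (intro allI impI)
    fix al be :: "int list"
    define m where "m = Max {length al + 1, length be - 1, 2}"
    define al' where "al' = pad (m - 1) al"
    define be' where "be' = pad (m + 1) be"
    have "length al + 1 \<le> m" "length be - 1 \<le> m" "2 \<le> m"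
      unfolding m_def by (auto intro!: Max_ge)
    then have len: "Suc (length al') = m" "length be' = Suc m"
      by (auto simp: al'_def be'_def pad_def)
    define u where "u = shift (map (\<lambda>x. x - 1) al')"
    define v where "v = map (\<lambda>x. x + 1) (shift be')"
    have first: "shift (map (\<lambda>x. x - 1) al' @ [be' ! k + int m - int k]) = u @ [v ! k]"
      if "k \<le> m" for k
      using that len by (simp add: shift_snoc u_def v_def)
    have second: "shift (map (\<lambda>x. x + 1) (take k be') @ drop (Suc k) be') =
        take k v @ drop (Suc k) v" if "k \<le> m" for k
      using that len by (intro nth_equalityI) (auto simp: v_def nth_append min_def)
    have "(\<Sum>k\<le>Suc (length u). (- 1) ^ k * weighted_alternant h y (u @ [v ! k]) *
        weighted_alternant h y (take k v @ drop (Suc k) v)) = 0"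
      by (rule weighted_alternant_pluecker[OF h]) (use len in \<open>auto simp: u_def v_def\<close>)
    moreover have "Suc (length u) = m" using len by (simp add: u_def)
    ultimately have "(\<Sum>k = 0..m. (- 1) ^ k *
        extension b (map (\<lambda>x. x - 1) al' @ [be' ! k + int m - int k]) *
        extension b (map (\<lambda>x. x + 1) (take k be') @ drop (Suc k) be')) = 0"
      by (simp add: ext first second atLeast0AtMost)
    then show "let m = Max {length al + 1, length be - 1, 2}; al' = pad (m - 1) al;
        be' = pad (m + 1) be
      in (\<Sum>k = 0..m. (- 1) ^ k *
        extension b (map (\<lambda>x. x - 1) al' @ [be' ! k + int m - int k]) *
        extension b (map (\<lambda>x. x + 1) (take k be') @ drop (Suc k) be')) = 0"
      by (simp only: Let_def m_def al'_def be'_def)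
  qed
qed

section \<open>Schur functions\<close>

lemma complete_homogeneous_neg: "i < 0 \<Longrightarrow> complete_homogeneous q i = 0"
  by (simp add: complete_homogeneous_def)

lemma complete_homogeneous_0: "complete_homogeneous q 0 = 1"
  by (simp add: complete_homogeneous_def complete_series_def const_def)

lemma schur_eq_alternant: "schur q la = alternant (complete_homogeneous q) (shift la)"
  unfolding schur_def alternant_def
  by (intro arg_cong[where f = det] eq_matI) (auto simp: algebra_simps)

theorem theorem2p2:
  shows "pluecker_relations
    (\<lambda>la. schur (\<lambda>k. var (Q k)) la * (\<Prod>w\<in>cells la. var (Y (cell_content w))))"
  by (rule pluecker_relations_content_weighted[where h = "complete_homogeneous (\<lambda>k. var (Q k))"
        and y = "\<lambda>c. var (Y c)"])
    (simp_all add: complete_homogeneous_neg complete_homogeneous_0 schur_eq_alternant)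

end
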